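(* Every two dimensional subspace of complex $\ell_\infty^3$ has the $2$-summing property.
   Context: Scalars are complex; $\ell_\infty^3$ is $\mathbb{C}^3$ with the max norm. For an operator $T:X\to Y$ between Banach spaces, $\pi_2(T)=\sup\big(\sum_{i=1}^n\|TUe_i\|^2\big)^{1/2}$, the supremum over all $n\ge1$ and operators $U:\ell_2^n\to X$ with $\|U\|\le1$, where $(e_i)$ is the unit vector basis of $\ell_2^n$. $X$ has the $2$-summing property if $\pi_2(T)=\|T\|$ for every bounded linear operator $T:X\to\ell_2$. *)

theory Defs
  imports "HOL-Analysis.Analysis" "HOL-Library.Function_Algebras"
begin

text \<open>A complex normed space is given by a carrier inside an ambient additive group,
  together with its scalar multiplication and its norm. The addition is that of the
  ambient type.\<close>

record 'a cnspace =
  cn_carrier :: "'a set"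
  cn_scale :: "complex \<Rightarrow> 'a \<Rightarrow> 'a"
  cn_norm :: "'a \<Rightarrow> real"

text \<open>Operators are total functions of which only the values on the carrier matter.\<close>

definition bounded_operator ::
  "('a::ab_group_add) cnspace \<Rightarrow> ('b::ab_group_add) cnspace \<Rightarrow> ('a \<Rightarrow> 'b) \<Rightarrow> bool" where
  "bounded_operator X Y T \<longleftrightarrow>
     (\<forall>x\<in>cn_carrier X. T x \<in> cn_carrier Y) \<and>
     (\<forall>x\<in>cn_carrier X. \<forall>y\<in>cn_carrier X. T (x + y) = T x + T y) \<and>
     (\<forall>c. \<forall>x\<in>cn_carrier X. T (cn_scale X c x) = cn_scale Y c (T x)) \<and>
     (\<exists>B. \<forall>x\<in>cn_carrier X. cn_norm Y (T x) \<le> B * cn_norm X x)"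

definition operator_norm :: "'a cnspace \<Rightarrow> 'b cnspace \<Rightarrow> ('a \<Rightarrow> 'b) \<Rightarrow> real" where
  "operator_norm X Y T = Sup {cn_norm Y (T x) |x. x \<in> cn_carrier X \<and> cn_norm X x \<le> 1}"

definition l2_norm :: "(nat \<Rightarrow> complex) \<Rightarrow> real" where
  "l2_norm x = sqrt (\<Sum>i. (cmod (x i))\<^sup>2)"

definition ell2 :: "(nat \<Rightarrow> complex) cnspace" where
  "ell2 = \<lparr>cn_carrier = {x. summable (\<lambda>i. (cmod (x i))\<^sup>2)},
           cn_scale = (\<lambda>c x i. c * x i), cn_norm = l2_norm\<rparr>"

text \<open>The dimension \<open>n\<close> varies inside the definition of \<open>pi2\<close>, so the \<open>n\<close>-dimensional
  Hilbert space consists of the sequences supported on \<open>{..<n}\<close>; its unit vectors are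
  indexed by \<open>0, ..., n - 1\<close>.\<close>

definition ell2_fin :: "nat \<Rightarrow> (nat \<Rightarrow> complex) cnspace" where
  "ell2_fin n = \<lparr>cn_carrier = {x. \<forall>i\<ge>n. x i = 0},
                 cn_scale = (\<lambda>c x i. c * x i), cn_norm = l2_norm\<rparr>"

definition unit_vector :: "nat \<Rightarrow> nat \<Rightarrow> complex" where
  "unit_vector i = (\<lambda>j. if j = i then 1 else 0)"

text \<open>The supremum may be infinite for a general operator, hence the type \<^typ>\<open>ennreal\<close>.\<close>

definition pi2 ::
  "('a::ab_group_add) cnspace \<Rightarrow> ('b::ab_group_add) cnspace \<Rightarrow> ('a \<Rightarrow> 'b) \<Rightarrow> ennreal" where
  "pi2 X Y T = Sup {ennreal (sqrt (\<Sum>i<n. (cn_norm Y (T (U (unit_vector i))))\<^sup>2)) |n U.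
     n \<ge> 1 \<and> bounded_operator (ell2_fin n) X U \<and> operator_norm (ell2_fin n) X U \<le> 1}"

definition two_summing_property :: "('a::ab_group_add) cnspace \<Rightarrow> bool" where
  "two_summing_property X \<longleftrightarrow>
     (\<forall>T. bounded_operator X ell2 T \<longrightarrow> pi2 X ell2 T = ennreal (operator_norm X ell2 T))"

text \<open>A subspace of the \<open>n\<close>-dimensional complex space with the maximum norm, where \<open>n\<close> is
  the cardinality of the index type. The library norm on this type is the Euclidean one,
  and \<^const>\<open>infnorm\<close> takes the maximum over real and imaginary parts, so neither is used.\<close>

definition max_norm :: "complex ^ 'n \<Rightarrow> real" where
  "max_norm x = Max (range (\<lambda>i. cmod (x $ i)))"

definition linf_subspace :: "(complex ^ 'n) set \<Rightarrow> (complex ^ 'n) cnspace" where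
  "linf_subspace E = \<lparr>cn_carrier = E, cn_scale = (*s), cn_norm = max_norm\<rparr>"

end

theory Submission
  imports Defs
begin

text \<open>With respect to a basis \<open>a, b\<close> of \<open>E\<close> dual to two of the coordinates, an operator \<open>U\<close>
  into \<open>E\<close> enters both \<open>\<parallel>U\<parallel>\<close> and \<open>\<Sum>\<parallel>T U e\<^sub>i\<parallel>\<^sup>2\<close> only through the positive semidefinite matrix
  \<open>U U\<^sup>*\<close>, with diagonal \<open>p, r\<close> and off-diagonal entry \<open>z\<close>, where \<open>|z|\<^sup>2 \<le> p r\<close>. The norm
  condition amounts to \<open>p \<le> 1\<close>, \<open>r \<le> 1\<close> and a bound on \<open>Re (z w)\<close> for a fixed \<open>w\<close>. Hence
  \<open>z\<close> may be moved along a chord of the disc \<open>|z|\<^sup>2 \<le> p r\<close> on which \<open>Re (z w)\<close> is constant, in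
  the direction in which \<open>\<Sum>\<parallel>T U e\<^sub>i\<parallel>\<^sup>2\<close> does not decrease. On the boundary circle the matrix has
  rank one, so it comes from a single vector of the unit ball of \<open>E\<close>.\<close>

section \<open>Chords of a disc and rank-one matrices\<close>

text \<open>Moving \<open>z\<close> in a direction \<open>v\<close> with
  \<open>Re (v * w) = 0\<close> keeps \<open>Re (z * w)\<close> fixed, and the sign of
  \<open>v\<close> can be chosen so that \<open>Re (z * q)\<close> does not decrease. Such a ray
  from a point of the disc meets the bounding circle.\<close>

lemma chord_endpoint:
  fixes z w q :: complex
  assumes "cmod z \<le> \<rho>"
  obtains z' where "cmod z' = \<rho>" "Re (z' * w) = Re (z * w)" "Re (z * q) \<le> Re (z' * q)"
proof -
  \<comment> \<open>The product of \<open>\<i> * cnj w\<close> with \<open>w\<close> is purely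
    imaginary. For \<open>w = 0\<close> every direction is admissible, but a nonzero one is
    needed.\<close>
  define v0 where "v0 = (if w = 0 then 1 else \<i> * cnj w)"
  define v where "v = (if 0 \<le> Re (v0 * q) then v0 else - v0)"
  have v: "v \<noteq> 0" "Re (v * w) = 0" "0 \<le> Re (v * q)"
    by (auto simp: v_def v0_def)
  \<comment> \<open>By the triangle inequality a displacement of length
    \<open>\<rho> + cmod z\<close> leaves the open disc, so the intermediate value theorem applies
    on \<open>[0, t1]\<close>.\<close>
  define t1 where "t1 = (\<rho> + cmod z) / cmod v"
  have "0 \<le> \<rho>"
    using assms norm_ge_zero order_trans by blast
  then have t1: "0 \<le> t1" "t1 * cmod v = \<rho> + cmod z"
    using v by (auto simp: t1_def)
  have "cmod (of_real t1 * v) \<le> cmod (z + of_real t1 * v) + cmod z"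
    using norm_triangle_ineq4[of "z + of_real t1 * v" z] by simp
  then have "\<rho> \<le> cmod (z + of_real t1 * v)"
    using t1 by (simp add: norm_mult)
  then have "\<exists>t\<ge>0. t \<le> t1 \<and> cmod (z + of_real t * v) = \<rho>"
    using assms t1 by (intro IVT') (auto intro!: continuous_intros)
  then obtain t where t: "0 \<le> t" "cmod (z + of_real t * v) = \<rho>"
    by blast
  have Re_eq: "Re ((z + of_real t * v) * u) = Re (z * u) + t * Re (v * u)" for u
    by (simp add: algebra_simps)
  show thesis
    by (rule that[of "z + of_real t * v"]) (use t v Re_eq in auto)
qed

text \<open>A positive semidefinite 2 by 2 matrix with determinant zero is the outer product of a
  vector with its conjugate. If \<open>p = 0\<close>, then \<open>z = 0\<close> and only
  \<open>r\<close> has to be matched.\<close>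

lemma rank_one_decomposition:
  fixes z :: complex
  assumes "0 \<le> p" "0 \<le> r" "cmod z = sqrt (p * r)"
  obtains \<alpha> \<beta> where "(cmod \<alpha>)\<^sup>2 = p" "(cmod \<beta>)\<^sup>2 = r" "\<alpha> * cnj \<beta> = z"
proof (cases "p = 0")
  case True
  show thesis
    by (rule that[of 0 "of_real (sqrt r)"]) (use True assms in auto)
next
  case False
  show thesis
  proof (rule that[of "of_real (sqrt p)" "cnj z / of_real (sqrt p)"])
    show "(cmod (cnj z / of_real (sqrt p)))\<^sup>2 = r"
      using False assms by (simp add: norm_divide power_divide)
  qed (use False assms in auto)
qed

section \<open>Squared norms of linear combinations\<close>

lemma cmod_combination_sq:
  "(cmod (\<alpha> * x + \<beta> * y))\<^sup>2 =
    (cmod \<alpha>)\<^sup>2 * (cmod x)\<^sup>2 + (cmod \<beta>)\<^sup>2 * (cmod y)\<^sup>2 + 2 * Re (\<alpha> * cnj \<beta> * (x * cnj y))"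
  unfolding cmod_power2 by (simp add: power2_eq_square algebra_simps)

text \<open>Read from right to left, this turns expressions in the Gram data \<open>p\<close>,
  \<open>r\<close>, \<open>z\<close> back into sums over the individual vectors.\<close>

lemma sum_combination:
  fixes \<alpha> \<beta> :: "'i \<Rightarrow> complex"
  shows "(\<Sum>i\<in>I. (cmod (\<alpha> i))\<^sup>2 * A + (cmod (\<beta> i))\<^sup>2 * B + 2 * Re (\<alpha> i * cnj (\<beta> i) * q)) =
    (\<Sum>i\<in>I. (cmod (\<alpha> i))\<^sup>2) * A + (\<Sum>i\<in>I. (cmod (\<beta> i))\<^sup>2) * B +
    2 * Re ((\<Sum>i\<in>I. \<alpha> i * cnj (\<beta> i)) * q)"
  by (simp only: sum.distrib sum_distrib_right sum_distrib_left Re_sum)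

text \<open>The expansion of \<open>cmod_combination_sq\<close> is summed termwise. The inner
  product series converges by comparison with the sum of the two square series.\<close>

lemma l2_norm_combination_sq:
  assumes X: "summable (\<lambda>k. (cmod (X k))\<^sup>2)" and Y: "summable (\<lambda>k. (cmod (Y k))\<^sup>2)"
  shows "(l2_norm (\<lambda>k. \<alpha> * X k + \<beta> * Y k))\<^sup>2 =
    (cmod \<alpha>)\<^sup>2 * (l2_norm X)\<^sup>2 + (cmod \<beta>)\<^sup>2 * (l2_norm Y)\<^sup>2 +
    2 * Re (\<alpha> * cnj \<beta> * (\<Sum>k. X k * cnj (Y k)))"
proof -
  have sq: "(l2_norm Z)\<^sup>2 = (\<Sum>k. (cmod (Z k))\<^sup>2)" if "summable (\<lambda>k. (cmod (Z k))\<^sup>2)" for Z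
    using that by (simp add: l2_norm_def suminf_nonneg)
  have "cmod (X k * cnj (Y k)) \<le> (cmod (X k))\<^sup>2 + (cmod (Y k))\<^sup>2" for k
    using sum_squares_bound[of "cmod (X k)" "cmod (Y k)"] mult_nonneg_nonneg[of "cmod (X k)" "cmod (Y k)"]
    by (simp add: norm_mult del: mult_nonneg_nonneg)
  then have XY: "summable (\<lambda>k. X k * cnj (Y k))"
    by (intro summable_comparison_test'[OF summable_add[OF X Y]])
  have sums: "(\<lambda>k. (cmod (\<alpha> * X k + \<beta> * Y k))\<^sup>2) sums
    ((cmod \<alpha>)\<^sup>2 * (\<Sum>k. (cmod (X k))\<^sup>2) + (cmod \<beta>)\<^sup>2 * (\<Sum>k. (cmod (Y k))\<^sup>2) +
    2 * Re (\<alpha> * cnj \<beta> * (\<Sum>k. X k * cnj (Y k))))"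
    unfolding cmod_combination_sq
    by (intro sums_add sums_mult sums_Re summable_sums X Y XY)
  show ?thesis
    using sums_summable[OF sums] sums_unique[OF sums] by (simp add: sq X Y)
qed

section \<open>Norms and operators\<close>

lemma l2_norm_nonneg: "summable (\<lambda>i. (cmod (x i))\<^sup>2) \<Longrightarrow> 0 \<le> l2_norm x"
  by (simp add: l2_norm_def suminf_nonneg)

lemma l2_norm_finite: "\<forall>i\<ge>n. x i = 0 \<Longrightarrow> l2_norm x = L2_set (\<lambda>i. cmod (x i)) {..<n}"
  unfolding l2_norm_def L2_set_def by (subst suminf_finite[of "{..<n}"]) auto

lemma max_norm_le_iff: "max_norm x \<le> B \<longleftrightarrow> (\<forall>i. cmod (x $ i) \<le> B)"
  by (auto simp: max_norm_def)

lemma max_norm_nonneg [simp]: "0 \<le> max_norm x"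
  using max_norm_le_iff[of x "max_norm x"] norm_ge_zero order_trans by blast

lemma bounded_operator_le_operator_norm:
  assumes "bounded_operator X Y T" "\<And>x. x \<in> cn_carrier X \<Longrightarrow> 0 \<le> cn_norm X x"
    "x \<in> cn_carrier X" "cn_norm X x \<le> 1"
  shows "cn_norm Y (T x) \<le> operator_norm X Y T"
proof -
  obtain B where B: "\<forall>x\<in>cn_carrier X. cn_norm Y (T x) \<le> B * cn_norm X x"
    using assms(1) by (auto simp: bounded_operator_def)
  \<comment> \<open>The constant \<open>B\<close> may be negative, for instance on a trivial
    carrier, so its absolute value serves as the bound.\<close>
  have "cn_norm Y (T x) \<le> \<bar>B\<bar>" if "x \<in> cn_carrier X" "cn_norm X x \<le> 1" for x
  proof -
    have "B * cn_norm X x \<le> \<bar>B\<bar> * 1"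
      using that assms(2) by (intro mult_mono) auto
    then show ?thesis using B that by fastforce
  qed
  then have "bdd_above {cn_norm Y (T x) |x. x \<in> cn_carrier X \<and> cn_norm X x \<le> 1}"
    by (auto simp: bdd_above_def)
  then show ?thesis
    unfolding operator_norm_def by (rule cSup_upper[rotated]) (use assms in auto)
qed

lemma operator_on_ell2_fin:
  assumes U: "bounded_operator (ell2_fin n) (linf_subspace E) U" and v: "\<forall>i\<ge>n. v i = 0"
  shows "U v = (\<Sum>i<n. v i *s U (unit_vector i))"
proof -
  have add: "U (x + y) = U x + U y" if "\<forall>i\<ge>n. x i = 0" "\<forall>i\<ge>n. y i = 0" for x y
    using U that by (simp add: bounded_operator_def ell2_fin_def)
  have scale: "U (\<lambda>i. c * x i) = c *s U x" if "\<forall>i\<ge>n. x i = 0" for c x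
    using U that by (simp add: bounded_operator_def ell2_fin_def linf_subspace_def)
  have "U (\<lambda>i. if i < m then v i else 0) = (\<Sum>i<m. v i *s U (unit_vector i))" if "m \<le> n" for m
    using that
  proof (induction m)
    case 0
    show ?case using scale[of "\<lambda>i. 0" 0] by simp
  next
    case (Suc m)
    have "(\<lambda>i. if i < Suc m then v i else 0) =
        (\<lambda>i. if i < m then v i else 0) + (\<lambda>i. v m * unit_vector m i)"
      by (auto simp: fun_eq_iff unit_vector_def less_Suc_eq)
    then show ?case
      using Suc by (simp add: add scale unit_vector_def)
  qed
  moreover have "v = (\<lambda>i. if i < n then v i else 0)"
    using v by (auto simp: fun_eq_iff)
  ultimately show ?thesis
    by (metis order_refl)
qed

text \<open>The \<open>j\<close>-th coordinate of \<open>U\<close> is a linear functional on a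
  Hilbert space. Its norm is the Euclidean norm of its row, attained at the normalised conjugate
  row.\<close>

lemma row_sq_sum_le_1:
  assumes U: "bounded_operator (ell2_fin n) (linf_subspace E) U"
    and norm: "operator_norm (ell2_fin n) (linf_subspace E) U \<le> 1"
  shows "(\<Sum>i<n. (cmod (U (unit_vector i) $ j))\<^sup>2) \<le> 1"
proof -
  define s where "s = (\<Sum>i<n. (cmod (U (unit_vector i) $ j))\<^sup>2)"
  \<comment> \<open>If \<open>s = 0\<close>, division by zero makes \<open>v\<close> the zero
    vector; the quotients \<open>s / s\<close> and \<open>s / sqrt s\<close> below are then 0 as
    well.\<close>
  define v where "v i = (if i < n then cnj (U (unit_vector i) $ j) / of_real (sqrt s) else 0)" for i
  have s: "0 \<le> s" by (simp add: s_def sum_nonneg)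
  have "(\<Sum>i<n. (cmod (v i))\<^sup>2) = s / s"
    using s by (simp add: v_def norm_divide power_divide s_def flip: sum_divide_distrib)
  then have "l2_norm v \<le> 1"
    using l2_norm_finite[of n v] by (simp add: v_def L2_set_def)
  then have "cn_norm (linf_subspace E) (U v) \<le> operator_norm (ell2_fin n) (linf_subspace E) U"
    by (intro bounded_operator_le_operator_norm[OF U])
      (auto simp: ell2_fin_def v_def l2_norm_finite)
  then have "cn_norm (linf_subspace E) (U v) \<le> 1"
    using norm by simp
  then have "cmod (U v $ j) \<le> 1"
    by (simp add: linf_subspace_def max_norm_le_iff)
  moreover have "cnj c * c = (of_real (cmod c))\<^sup>2" for c
    using complex_norm_square[of c] by (simp add: mult.commute)
  then have "U v $ j = (\<Sum>i<n. of_real ((cmod (U (unit_vector i) $ j))\<^sup>2) / of_real (sqrt s))"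
    using operator_on_ell2_fin[OF U, of v] by (simp add: v_def)
  moreover have "\<dots> = of_real (s / sqrt s)"
    by (simp add: s_def sum_divide_distrib)
  ultimately have "sqrt s \<le> 1"
    using s by (simp add: real_div_sqrt norm_divide)
  then show ?thesis
    by (simp add: s_def)
qed

section \<open>Reduction to a single vector\<close>

text \<open>Gaussian elimination brings a basis \<open>u, w\<close> of \<open>E\<close> to reduced
  echelon form with pivot coordinates \<open>j\<close> and \<open>k\<close>.\<close>

lemma dual_coordinate_basis:
  fixes E :: "(complex ^ 'n) set"
  assumes E: "vec.subspace E" "vec.dim E = 2"
  obtains j k a b where "j \<noteq> k" "a \<in> E" "b \<in> E" "a $ j = 1" "a $ k = 0" "b $ j = 0" "b $ k = 1"
    "\<And>x. x \<in> E \<Longrightarrow> x = (x $ j) *s a + (x $ k) *s b"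
proof -
  obtain B where B: "B \<subseteq> E" "vec.independent B" "E \<subseteq> vec.span B" "card B = 2"
    using vec.basis_exists[of E] E by metis
  obtain u w where uw: "B = {u, w}" "u \<noteq> w"
    using B(4) by (auto simp: card_2_iff)
  have "u \<noteq> 0"
    using B uw vec.dependent_zero by blast
  then obtain j where j: "u $ j \<noteq> 0"
    by (auto simp: vec_eq_iff)
  define w' where "w' = w - (w $ j / u $ j) *s u"
  have w'j: "w' $ j = 0"
    using j by (simp add: w'_def)
  have "w \<notin> vec.span {u}"
    using B(2) uw by (auto simp: vec.independent_insert insert_commute[of u])
  then have "w' \<noteq> 0"
    by (metis w'_def eq_iff_diff_eq_0 insertI1 vec.span_base vec.span_scale)
  then obtain k where k: "w' $ k \<noteq> 0"
    by (auto simp: vec_eq_iff)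
  define b where "b = (1 / w' $ k) *s w'"
  define a where "a = (1 / u $ j) *s (u - (u $ k) *s b)"
  have ab: "a $ j = 1" "a $ k = 0" "b $ j = 0" "b $ k = 1"
    using j k w'j by (auto simp: a_def b_def)
  have "w' \<in> E"
    using B uw E by (auto simp: w'_def intro!: vec.subspace_diff vec.subspace_scale)
  then have "b \<in> E"
    using E by (simp add: b_def vec.subspace_scale)
  moreover have "a \<in> E"
    using B uw E \<open>b \<in> E\<close> by (auto simp: a_def intro!: vec.subspace_diff vec.subspace_scale)
  moreover have "x = (x $ j) *s a + (x $ k) *s b" if "x \<in> E" for x
  proof -
    have u: "u = (u $ j) *s a + (u $ k) *s b"
      using j by (simp add: a_def)
    have u_span: "u \<in> vec.span {a, b}"
      by (subst u, intro vec.span_add vec.span_scale vec.span_base) auto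
    have w: "w = (w' $ k) *s b + (w $ j / u $ j) *s u"
      using k by (simp add: b_def w'_def)
    have "w \<in> vec.span {a, b}"
      by (subst w, intro vec.span_add vec.span_scale u_span) (auto intro: vec.span_base)
    with u_span have "vec.span B \<subseteq> vec.span {a, b}"
      using uw by (intro vec.span_minimal) auto
    then have "x \<in> vec.span {a, b}"
      using that B by blast
    then obtain s t where "x = s *s a + t *s b"
      by (auto simp: vec.span_insert vec.span_singleton) (metis add.commute diff_add_cancel)
    then show ?thesis
      using ab by simp
  qed
  moreover have "j \<noteq> k"
    using ab by auto
  ultimately show thesis
    using that ab by blast
qed

text \<open>Beyond the coordinates \<open>j\<close> and \<open>k\<close>, which fix \<open>p\<close>
  and \<open>r\<close>, only one coordinate \<open>l\<close> remains in dimension three. It puts a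
  single real linear constraint on \<open>z\<close>, which leaves a chord to move along.\<close>

lemma sum_sq_le_single_vector:
  fixes E :: "(complex ^ 3) set" and u :: "'i \<Rightarrow> complex ^ 3"
  assumes E: "vec.subspace E" "vec.dim E = 2"
    and T: "bounded_operator (linf_subspace E) ell2 T"
    and u: "\<And>i. i \<in> I \<Longrightarrow> u i \<in> E" "\<And>j. (\<Sum>i\<in>I. (cmod (u i $ j))\<^sup>2) \<le> 1"
  obtains x where "x \<in> E" "max_norm x \<le> 1" "(\<Sum>i\<in>I. (l2_norm (T (u i)))\<^sup>2) \<le> (l2_norm (T x))\<^sup>2"
proof -
  obtain j k a b where jk: "j \<noteq> k" and ab: "a \<in> E" "b \<in> E"
    and coords: "a $ j = 1" "a $ k = 0" "b $ j = 0" "b $ k = 1"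
    and expand: "\<And>x. x \<in> E \<Longrightarrow> x = (x $ j) *s a + (x $ k) *s b"
    using dual_coordinate_basis[OF E] by metis
  have "card (UNIV - {j, k}) = 1"
    using jk by (simp add: card_Diff_subset)
  then obtain l where "UNIV - {j, k} = {l}"
    by (auto simp: card_1_singleton_iff)
  then have UNIV_eq: "m = j \<or> m = k \<or> m = l" for m
    by blast
  have in_E: "s *s a + t *s b \<in> E" for s t
    using E ab by (simp add: vec.subspace_add vec.subspace_scale)
  have T_comb: "T (s *s a + t *s b) = (\<lambda>m. s * T a m + t * T b m)" for s t
  proof -
    have "s *s a \<in> E" "t *s b \<in> E"
      using E ab by (auto intro: vec.subspace_scale)
    then show ?thesis
      using T ab by (auto simp: bounded_operator_def linf_subspace_def ell2_def)
  qed
  have summ: "summable (\<lambda>m. (cmod (T a m))\<^sup>2)" "summable (\<lambda>m. (cmod (T b m))\<^sup>2)"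
    using T ab by (auto simp: bounded_operator_def linf_subspace_def ell2_def)
  define \<alpha> \<beta> where "\<alpha> i = u i $ j" and "\<beta> i = u i $ k" for i
  define p r z where "p = (\<Sum>i\<in>I. (cmod (\<alpha> i))\<^sup>2)" and "r = (\<Sum>i\<in>I. (cmod (\<beta> i))\<^sup>2)"
    and "z = (\<Sum>i\<in>I. \<alpha> i * cnj (\<beta> i))"
  \<comment> \<open>The numbers \<open>q\<close> and \<open>w\<close> are the coefficients of
    \<open>z\<close> in the sum of the \<open>(l2_norm (T (u i)))\<^sup>2\<close> and in the
    \<open>l\<close>-th row sum, respectively.\<close>
  define q where "q = (\<Sum>m. T a m * cnj (T b m))"
  define w where "w = a $ l * cnj (b $ l)"
  have u_eq: "u i = \<alpha> i *s a + \<beta> i *s b" if "i \<in> I" for i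
    using expand u that by (simp add: \<alpha>_def \<beta>_def)
  have p: "0 \<le> p" "p \<le> 1" and r: "0 \<le> r" "r \<le> 1"
    using u by (auto simp: p_def r_def \<alpha>_def \<beta>_def intro: sum_nonneg)
  \<comment> \<open>Cauchy-Schwarz places \<open>z\<close> in the disc of radius
    \<open>sqrt (p * r)\<close>.\<close>
  have "cmod z \<le> (\<Sum>i\<in>I. \<bar>cmod (\<alpha> i)\<bar> * \<bar>cmod (\<beta> i)\<bar>)"
    unfolding z_def by (rule order_trans[OF norm_sum]) (simp add: norm_mult)
  also have "\<dots> \<le> sqrt (p * r)"
    using L2_set_mult_ineq[of "\<lambda>i. cmod (\<alpha> i)" "\<lambda>i. cmod (\<beta> i)" I]
    by (simp add: L2_set_def p_def r_def real_sqrt_mult)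
  finally obtain z' where z': "cmod z' = sqrt (p * r)" "Re (z' * w) = Re (z * w)"
      "Re (z * q) \<le> Re (z' * q)"
    using chord_endpoint by metis
  obtain \<gamma> \<delta> where gd: "(cmod \<gamma>)\<^sup>2 = p" "(cmod \<delta>)\<^sup>2 = r" "\<gamma> * cnj \<delta> = z'"
    using rank_one_decomposition[OF p(1) r(1) z'(1)] .
  define x where "x = \<gamma> *s a + \<delta> *s b"
  have "(cmod (x $ l))\<^sup>2 = p * (cmod (a $ l))\<^sup>2 + r * (cmod (b $ l))\<^sup>2 + 2 * Re (z * w)"
    using gd z' cmod_combination_sq[of \<gamma> "a $ l" \<delta> "b $ l"] by (simp add: x_def w_def)
  also have "\<dots> = (\<Sum>i\<in>I. (cmod (u i $ l))\<^sup>2)"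
    unfolding p_def r_def z_def sum_combination[symmetric] w_def
    by (intro sum.cong refl) (simp add: u_eq cmod_combination_sq)
  also have "\<dots> \<le> 1"
    by (rule u)
  \<comment> \<open>The coordinates \<open>j\<close> and \<open>k\<close> of \<open>x\<close> are
    \<open>\<gamma>\<close> and \<open>\<delta>\<close>, with squared moduli \<open>p\<close> and
    \<open>r\<close>.\<close>
  finally have "cmod (x $ m) \<le> 1" for m
    using UNIV_eq[of m] gd p r coords by (auto simp: x_def abs_square_le_1)
  then have "max_norm x \<le> 1"
    by (simp add: max_norm_le_iff)
  moreover have "(\<Sum>i\<in>I. (l2_norm (T (u i)))\<^sup>2) =
      p * (l2_norm (T a))\<^sup>2 + r * (l2_norm (T b))\<^sup>2 + 2 * Re (z * q)"
    unfolding p_def r_def z_def sum_combination[symmetric] q_def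
    by (intro sum.cong refl) (simp only: u_eq T_comb l2_norm_combination_sq[OF summ])
  then have "(\<Sum>i\<in>I. (l2_norm (T (u i)))\<^sup>2) \<le> (l2_norm (T x))\<^sup>2"
    using z' by (simp add: x_def T_comb l2_norm_combination_sq[OF summ] gd flip: q_def)
  ultimately show thesis
    using that in_E x_def by blast
qed

section \<open>Comparison of the two norms\<close>

text \<open>The case \<open>n = 1\<close> of the supremum suffices: a vector \<open>x\<close> of the
  unit ball gives the operator sending \<open>c\<close> to \<open>c 0 *s x\<close>, of norm at most
  1. An infinite \<open>pi2\<close> is trivial, so \<open>m\<close> is its finite value.\<close>

lemma operator_norm_le_pi2:
  assumes E: "vec.subspace E"
  shows "ennreal (operator_norm (linf_subspace E) ell2 T) \<le> pi2 (linf_subspace E) ell2 T"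
proof (cases "pi2 (linf_subspace E) ell2 T")
  case (real m)
  have "l2_norm (T x) \<le> m" if x: "x \<in> E" "max_norm x \<le> 1" for x
  proof -
    define U where "U c = c 0 *s x" for c :: "nat \<Rightarrow> complex"
    have norm_U: "max_norm (U c) \<le> l2_norm c" if "\<forall>i\<ge>1. c i = 0" for c
    proof -
      have "cmod (c 0) * cmod (x $ i) \<le> cmod (c 0) * 1" for i
        using x by (intro mult_left_mono) (auto simp: max_norm_le_iff)
      moreover have "l2_norm c = cmod (c 0)"
        using l2_norm_finite[OF that] by (simp add: L2_set_def)
      ultimately show ?thesis
        by (simp add: U_def max_norm_le_iff norm_mult)
    qed
    have "bounded_operator (ell2_fin 1) (linf_subspace E) U"
      unfolding bounded_operator_def
      using norm_U x E
      by (auto simp: ell2_fin_def linf_subspace_def U_def vec.subspace_scale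
          vector_sadd_rdistrib intro!: exI[of _ 1])
    moreover have "operator_norm (ell2_fin 1) (linf_subspace E) U \<le> 1"
      unfolding operator_norm_def
    proof (rule cSup_least)
      have "l2_norm (\<lambda>i. 0) \<le> 1"
        by (simp add: l2_norm_def)
      then show "{cn_norm (linf_subspace E) (U c) |c.
          c \<in> cn_carrier (ell2_fin 1) \<and> cn_norm (ell2_fin 1) c \<le> 1} \<noteq> {}"
        by (auto simp: ell2_fin_def intro!: exI[of _ "\<lambda>i. 0"])
    next
      fix y
      assume "y \<in> {cn_norm (linf_subspace E) (U c) |c.
          c \<in> cn_carrier (ell2_fin 1) \<and> cn_norm (ell2_fin 1) c \<le> 1}"
      then obtain c where "y = max_norm (U c)" "\<forall>i\<ge>1. c i = 0" "l2_norm c \<le> 1"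
        by (auto simp: ell2_fin_def linf_subspace_def)
      then show "y \<le> 1"
        using norm_U[of c] by simp
    qed
    ultimately have "ennreal (sqrt (\<Sum>i<1. (cn_norm ell2 (T (U (unit_vector i))))\<^sup>2))
        \<le> pi2 (linf_subspace E) ell2 T"
      unfolding pi2_def by (intro Sup_upper) blast
    then show ?thesis
      using real by (simp add: ell2_def U_def unit_vector_def)
  qed
  moreover have "0 \<in> E" "max_norm 0 \<le> 1"
    using E by (auto simp: vec.subspace_0 max_norm_le_iff)
  ultimately have "operator_norm (linf_subspace E) ell2 T \<le> m"
    unfolding operator_norm_def by (intro cSup_least) (auto simp: linf_subspace_def ell2_def)
  then show ?thesis
    using real by (simp add: ennreal_leI)
qed simp

theorem proposition4p4:
  fixes E :: "(complex ^ 3) set"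
  assumes "vec.subspace E" and "vec.dim E = 2"
  shows "two_summing_property (linf_subspace E)"
  unfolding two_summing_property_def
proof (intro allI impI antisym operator_norm_le_pi2 assms(1))
  fix T
  assume T: "bounded_operator (linf_subspace E) ell2 T"
  show "pi2 (linf_subspace E) ell2 T \<le> ennreal (operator_norm (linf_subspace E) ell2 T)"
    unfolding pi2_def
  proof (rule Sup_least, clarify, rule ennreal_leI)
    fix n U
    assume U: "bounded_operator (ell2_fin n) (linf_subspace E) U"
      and norm: "operator_norm (ell2_fin n) (linf_subspace E) U \<le> 1"
    have "U (unit_vector i) \<in> E" if "i \<in> {..<n}" for i
      using U that by (auto simp: bounded_operator_def ell2_fin_def linf_subspace_def unit_vector_def)
    \<comment> \<open>The images of the unit vectors have row sums at most 1, so one vector of the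
      unit ball dominates the whole sum.\<close>
    then obtain x where x: "x \<in> E" "max_norm x \<le> 1"
        "(\<Sum>i<n. (l2_norm (T (U (unit_vector i))))\<^sup>2) \<le> (l2_norm (T x))\<^sup>2"
      using sum_sq_le_single_vector[OF assms T, of "{..<n}" "\<lambda>i. U (unit_vector i)"]
        row_sq_sum_le_1[OF U norm] by metis
    have "l2_norm (T x) \<le> operator_norm (linf_subspace E) ell2 T"
      using bounded_operator_le_operator_norm[OF T, of x] x by (simp add: linf_subspace_def ell2_def)
    moreover have "0 \<le> l2_norm (T x)"
      using T x by (auto simp: bounded_operator_def linf_subspace_def ell2_def intro: l2_norm_nonneg)
    ultimately show "sqrt (\<Sum>i<n. (cn_norm ell2 (T (U (unit_vector i))))\<^sup>2)
        \<le> operator_norm (linf_subspace E) ell2 T"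
      using real_sqrt_le_mono[OF x(3)] by (simp add: ell2_def)
  qed
qed

end
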